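(* Let $G$ be a countable group and $\mathcal F\subset\mathcal P_G$ a Borel left-invariant lower family, where $\mathcal P_G$ is identified with the compact metrizable space $2^G$. Then: (1) for every ordinal $\alpha<\omega_1$ the family $\tau^\alpha(\mathcal F)$ is Borel in $\mathcal P_G$; (2) the family $\tau^*(\mathcal F)=\tau^{<\omega_1}(\mathcal F)$ is coanalytic; (3) if $\tau^*(\mathcal F)\ne\tau^\alpha(\mathcal F)$ for all $\alpha<\omega_1$, then $\tau^*(\mathcal F)$ is not Borel in $\mathcal P_G$.
   Context: Subsets $A\subset G$ are identified with their characteristic functions in $2^G$ (product topology). Left-invariant: $xF\in\mathcal F$ for $F\in\mathcal F$, $x\in G$; lower: closed under subsets. $\tau(\mathcal F)=\{A\subset G: xA\cap yA\in\mathcal F$ for all distinct $x,y\in G\}$, $\tau^0(\mathcal F)=\mathcal F$, $\tau^{<\alpha}(\mathcal F)=\bigcup_{\beta<\alpha}\tau^\beta(\mathcal F)$, $\tau^\alpha(\mathcal F)=\tau(\tau^{<\alpha}(\mathcal F))$ for $\alpha>0$; $\tau^*(\mathcal F)$ is the smallest family $\tilde{\mathcal F}\supset\mathcal F$ with $\tau(\tilde{\mathcal F})=\tilde{\mathcal F}$. A subset of a Polish space is analytic if it is a continuous image of a Polish space, coanalytic if its complement is analytic. *)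

theory Defs
  imports "HOL-Analysis.Analysis"
begin

text \<open>Groups are written additively via the (not necessarily commutative) class group_add;
  the left translate xA of the paper is  (+) x ` A.\<close>

definition left_invariant_family :: "'g::group_add set set \<Rightarrow> bool" where
  "left_invariant_family \<F> \<longleftrightarrow> (\<forall>F\<in>\<F>. \<forall>x. (+) x ` F \<in> \<F>)"

definition lower_family :: "'g set set \<Rightarrow> bool" where
  "lower_family \<F> \<longleftrightarrow> (\<forall>A\<in>\<F>. \<forall>B. B \<subseteq> A \<longrightarrow> B \<in> \<F>)"

definition tau_op :: "'g::group_add set set \<Rightarrow> 'g set set" where
  "tau_op \<F> = {A. \<forall>x y. x \<noteq> y \<longrightarrow> ((+) x ` A \<inter> (+) y ` A) \<in> \<F>}"

text \<open>Countable ordinals are represented by well-orders r on subsets of nat (alpha = order type of r).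
  tau_level r F a = tau^beta(F), where beta is the position of a in r.\<close>
definition tau_level :: "nat rel \<Rightarrow> 'g::group_add set set \<Rightarrow> nat \<Rightarrow> 'g set set" where
  "tau_level r \<F> = wfrec (r - Id)
     (\<lambda>L a. if underS r a = {} then \<F> else tau_op (\<Union>b\<in>underS r a. L b))"

definition tau_ord :: "nat rel \<Rightarrow> 'g::group_add set set \<Rightarrow> 'g set set" where
  "tau_ord r \<F> = (if Field r = {} then \<F> else tau_op (\<Union>a\<in>Field r. tau_level r \<F> a))"

definition tau_lt_omega1 :: "'g::group_add set set \<Rightarrow> 'g set set" where
  "tau_lt_omega1 \<F> = (\<Union>r\<in>{r::nat rel. Well_order r}. tau_ord r \<F>)"

definition tau_star :: "'g::group_add set set \<Rightarrow> 'g set set" where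
  "tau_star \<F> = (THE H. \<F> \<subseteq> H \<and> tau_op H = H \<and>
                   (\<forall>H'. \<F> \<subseteq> H' \<and> tau_op H' = H' \<longrightarrow> H \<subseteq> H'))"

text \<open>Identification of P_G with 2^G = ('g => bool) (product topology of discrete bool).\<close>
definition char_fam :: "'g set set \<Rightarrow> ('g \<Rightarrow> bool) set" where
  "char_fam \<F> = (\<lambda>A. (\<lambda>g. g \<in> A)) ` \<F>"

definition borel_family :: "'g set set \<Rightarrow> bool" where
  "borel_family \<F> \<longleftrightarrow> char_fam \<F> \<in> sets borel"

definition polish_topology :: "'a topology \<Rightarrow> bool" where
  "polish_topology X \<longleftrightarrow> completely_metrizable_space X \<and> separable_space X"

text \<open>Analytic = continuous image of a Polish space. Every Polish space has cardinality at most
  the continuum, hence is homeomorphic to a Polish topology on a subset of real.\<close>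
definition analytic_set :: "'b::topological_space set \<Rightarrow> bool" where
  "analytic_set S \<longleftrightarrow> (\<exists>(X::real topology) f. polish_topology X \<and>
      continuous_map X euclidean f \<and> f ` topspace X = S)"

definition coanalytic_family :: "'g set set \<Rightarrow> bool" where
  "coanalytic_family \<F> \<longleftrightarrow> analytic_set (UNIV - char_fam \<F>)"

end

theory Submission
  imports Defs
begin

text \<open>
  Write \<open>B \<prec> A\<close> if \<open>B = xA \<inter> yA \<notin> \<F>\<close> for some \<open>x \<noteq> y\<close>. For \<open>\<H> \<supseteq> \<F>\<close> a set belongs to
  \<open>\<tau>(\<H>)\<close> iff all its \<open>\<prec>\<close>-predecessors belong to \<open>\<H>\<close>. Hence \<open>\<tau>\<^sup>*(\<F>)\<close> is the accessible
  (well-founded) part of \<open>\<prec>\<close>, and a family closed under \<open>\<prec>\<close>-predecessors on which \<open>\<prec>\<close> has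
  countable rank lies in some \<open>\<tau>\<^sup>\<alpha>(\<F>)\<close> with \<open>\<alpha> < \<omega>\<^sub>1\<close>. Only countably many sets lie below a
  given \<open>A\<close>, so \<open>\<tau>\<^sup>*(\<F>)\<close> is the union of these \<open>\<tau>\<^sup>\<alpha>(\<F>)\<close>. Since \<open>\<prec>\<close> is a Borel relation, the
  sets from which an infinite descending chain starts form an analytic set. If \<open>\<tau>\<^sup>*(\<F>)\<close> is Borel,
  then the restriction of \<open>\<prec>\<close> to it is a well-founded Borel relation, whose rank is countable by
  the Kunen--Martin theorem.
\<close>

section \<open>Ranks of well-founded relations\<close>

text \<open>For well-founded \<open>W\<close>, \<open>rank_le W x y\<close> says that the ordinal rank of \<open>x\<close> is at most that of \<open>y\<close>.\<close>

inductive rank_le :: "'a rel \<Rightarrow> 'a \<Rightarrow> 'a \<Rightarrow> bool" for W where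
  rank_leI: "(\<And>x'. (x', x) \<in> W \<Longrightarrow> \<exists>y'. (y', y) \<in> W \<and> rank_le W x' y') \<Longrightarrow> rank_le W x y"

lemma rank_le_predecessor:
  assumes "rank_le W x y" "(x', x) \<in> W"
  obtains y' where "(y', y) \<in> W" "rank_le W x' y'"
  using assms by (auto elim: rank_le.cases)

lemma rank_le_trans: "rank_le W x y \<Longrightarrow> rank_le W y z \<Longrightarrow> rank_le W x z"
proof (induction arbitrary: z rule: rank_le.induct)
  case (rank_leI x y)
  show ?case
  proof (rule rank_le.rank_leI)
    fix x' assume "(x', x) \<in> W"
    then obtain y' where "(y', y) \<in> W" "\<And>z. rank_le W y' z \<Longrightarrow> rank_le W x' z"
      using rank_leI.IH by blast
    with rank_leI.prems show "\<exists>z'. (z', z) \<in> W \<and> rank_le W x' z'"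
      by (meson rank_le_predecessor)
  qed
qed

lemma rank_le_successor: "rank_le W x y \<Longrightarrow> (y, z) \<in> W \<Longrightarrow> rank_le W x z"
proof (induction arbitrary: z rule: rank_le.induct)
  case (rank_leI x y)
  then show ?case by (blast intro: rank_le.rank_leI)
qed

context
  fixes W :: "'a rel"
  assumes wf: "wf W"
begin

lemma not_rank_le_predecessor:
  assumes "\<not> rank_le W x y"
  obtains x' where "(x', x) \<in> W" "rank_le W y x'"
proof -
  have "\<exists>x'. (x', x) \<in> W \<and> rank_le W y x'"
    using assms
  proof (induction x arbitrary: y rule: wf_induct_rule[OF wf, case_names less])
    case (less x)
    then obtain x' where x': "(x', x) \<in> W" "\<And>y'. (y', y) \<in> W \<Longrightarrow> \<not> rank_le W x' y'"
      using rank_leI[of x W y] by blast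
    have "rank_le W y x'"
      using less.IH[OF x'(1) x'(2)] by (rule rank_leI)
    with x' show ?case by blast
  qed
  then show thesis using that by blast
qed

lemma rank_le_linear: "rank_le W x y \<or> rank_le W y x"
  by (blast elim: not_rank_le_predecessor intro: rank_le_successor)

lemma not_rank_le_if_predecessor: "(x, y) \<in> W \<Longrightarrow> \<not> rank_le W y x"
proof (induction y arbitrary: x rule: wf_induct_rule[OF wf, case_names less])
  case (less y)
  then show ?case by (blast elim: rank_le_predecessor)
qed

lemma wf_rank_less: "wf {(x, y). \<not> rank_le W y x}"
proof -
  have "rank_le W y x \<Longrightarrow> y \<in> Wellfounded.acc {(x, y). \<not> rank_le W y x}" for x y
  proof (induction x arbitrary: y rule: wf_induct_rule[OF wf, case_names less])
    case (less x)
    have "z \<in> Wellfounded.acc {(x, y). \<not> rank_le W y x}" if not_le: "\<not> rank_le W y z" for z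
    proof -
      obtain y' where "(y', y) \<in> W" "rank_le W z y'"
        using not_rank_le_predecessor[OF not_le] by blast
      moreover obtain x' where "(x', x) \<in> W" "rank_le W y' x'"
        using rank_le_predecessor[OF less.prems \<open>(y', y) \<in> W\<close>] by blast
      ultimately show ?thesis using less.IH rank_le_trans by metis
    qed
    then show ?case by (blast intro: accI)
  qed
  then show ?thesis using rank_le_linear by (blast intro: acc_wfI)
qed

end

lemma total_well_order_extension:
  fixes W :: "'a::wellorder rel"
  assumes "wf W"
  obtains r where "Well_order r" "Field r = UNIV" "W \<subseteq> r - Id"
proof -
  define r where "r = {(x, y). rank_le W x y \<and> (rank_le W y x \<longrightarrow> x \<le> y)}"
  have "wf (r - Id)"
  proof (rule wf_subset)
    let ?less = "{(x, y). \<not> rank_le W y x}"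
    let ?tie = "{(x, y). rank_le W y x \<and> rank_le W x y \<and> x < y}"
    show "wf (?less \<union> ?tie)"
    proof (rule wf_union_compatible)
      show "wf ?less" using assms by (rule wf_rank_less)
      show "wf ?tie" by (rule wf_subset[OF wf]) auto
      show "?less O ?tie \<subseteq> ?less"
        using rank_le_trans[of W] by fast
    qed
    show "r - Id \<subseteq> ?less \<union> ?tie" by (auto simp: r_def)
  qed
  moreover have "refl r" "total r"
    using rank_le_linear[OF assms] by (auto simp: r_def refl_on_def total_on_def)
  moreover have "antisym r" by (auto simp: r_def antisym_def)
  moreover have "trans r"
    unfolding trans_def
  proof (intro allI impI)
    fix x y z assume xy: "(x, y) \<in> r" and yz: "(y, z) \<in> r"
    have "x \<le> z" if "rank_le W z x"
      using xy yz that rank_le_trans[of W z x y] rank_le_trans[of W y z x] by (auto simp: r_def)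
    with xy yz show "(x, z) \<in> r" using rank_le_trans[of W x y z] by (auto simp: r_def)
  qed
  moreover have "Field r = UNIV" using \<open>refl r\<close> by (auto simp: Field_def refl_on_def)
  moreover have "W \<subseteq> r - Id"
    using rank_le_linear[OF assms] not_rank_le_if_predecessor[OF assms] by (fastforce simp: r_def)
  ultimately show thesis
    by (intro that[of r]) (auto simp: order_on_defs)
qed

definition countable_rank :: "'a rel \<Rightarrow> bool" where
  "countable_rank R \<longleftrightarrow> (\<exists>(r :: nat rel) \<rho>. Well_order r \<and> Field r = UNIV \<and>
     (\<forall>(x, y)\<in>R. (\<rho> x, \<rho> y) \<in> r - Id))"

lemma countable_rankE:
  assumes "countable_rank R"
  obtains r :: "nat rel" and \<rho> where "Well_order r" "Field r = UNIV"
    "\<And>x y. (x, y) \<in> R \<Longrightarrow> (\<rho> x, \<rho> y) \<in> r - Id"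
  using assms unfolding countable_rank_def by blast

lemma countable_rank_inv_image: "countable_rank R \<Longrightarrow> countable_rank (inv_image R f)"
  unfolding countable_rank_def by (fastforce simp: inv_image_def)

lemma countable_rank_if_countable:
  assumes "wf R" "countable R"
  shows "countable_rank R"
proof -
  have "countable (Field R)"
    unfolding Field_def Domain_fst Range_snd using assms(2) by simp
  define \<rho> where "\<rho> = to_nat_on (Field R)"
  have "inj_on \<rho> (Field R)" unfolding \<rho>_def by (intro inj_on_to_nat_on) fact
  then have "wf (map_prod \<rho> \<rho> ` R)"
    by (intro wf_map_prod_image_Dom_Ran assms(1)) (auto simp: Field_def dest: inj_onD)
  then obtain r :: "nat rel" where "Well_order r" "Field r = UNIV" "map_prod \<rho> \<rho> ` R \<subseteq> r - Id"
    by (rule total_well_order_extension)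
  then show ?thesis unfolding countable_rank_def by (intro exI[of _ r] exI[of _ \<rho>]) auto
qed

section \<open>Accessible parts\<close>

lemma not_acc_iff_descending_chain:
  "x \<notin> Wellfounded.acc R \<longleftrightarrow> (\<exists>c. c 0 = x \<and> (\<forall>n. (c (Suc n), c n) \<in> R))"
proof
  assume "x \<notin> Wellfounded.acc R"
  then have "\<exists>c. \<forall>n. (c n \<notin> Wellfounded.acc R \<and> (n = 0 \<longrightarrow> c n = x)) \<and> (c (Suc n), c n) \<in> R"
    by (intro dependent_nat_choice) (auto elim: not_acc_down)
  then show "\<exists>c. c 0 = x \<and> (\<forall>n. (c (Suc n), c n) \<in> R)" by blast
next
  assume "\<exists>c. c 0 = x \<and> (\<forall>n. (c (Suc n), c n) \<in> R)"
  moreover have "x \<in> Wellfounded.acc R \<Longrightarrow> c 0 = x \<Longrightarrow> \<exists>n. (c (Suc n), c n) \<notin> R" for c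
  proof (induction x arbitrary: c rule: acc_induct_rule[case_names acc])
    case (acc x)
    show ?case
    proof (cases "(c (Suc 0), c 0) \<in> R")
      case True
      then show ?thesis using acc.IH[of "c (Suc 0)" "\<lambda>n. c (Suc n)"] acc.prems by auto
    qed blast
  qed
  ultimately show "x \<notin> Wellfounded.acc R" by blast
qed

lemma wf_Restr_acc: "wf (Restr R (Wellfounded.acc R))"
proof (rule acc_wfI, rule allI)
  fix x
  show "x \<in> Wellfounded.acc (Restr R (Wellfounded.acc R))"
  proof (cases "x \<in> Wellfounded.acc R")
    case True
    then show ?thesis by induction (blast intro: accI)
  qed (blast intro: accI)
qed

lemma acc_inv_image_surj:
  assumes "surj f"
  shows "Wellfounded.acc (inv_image R f) = f -` Wellfounded.acc R"
proof -
  have down: "f -` Wellfounded.acc R \<subseteq> Wellfounded.acc (inv_image R f)"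
  proof
    fix x assume "x \<in> f -` Wellfounded.acc R"
    then have "f x \<in> Wellfounded.acc R" by simp
    then show "x \<in> Wellfounded.acc (inv_image R f)"
      by (induction "f x" arbitrary: x) (auto intro: accI)
  qed
  have "x \<in> Wellfounded.acc (inv_image R f) \<Longrightarrow> f x \<in> Wellfounded.acc R" for x
  proof (induction rule: acc_induct_rule[case_names acc])
    case (acc x)
    show ?case
    proof (rule accI)
      fix y assume "(y, f x) \<in> R"
      moreover obtain y' where "y = f y'" using assms by (rule surjE)
      ultimately show "y \<in> Wellfounded.acc R" using acc.IH by simp
    qed
  qed
  with down show ?thesis by blast
qed

section \<open>Continuous images of closed subsets of Baire space\<close>

text \<open>The library makes function types Hausdorff only as metric spaces; this instance covers \<open>2\<^sup>G\<close>.\<close>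

instantiation bool :: metric_space
begin

definition dist_bool :: "bool \<Rightarrow> bool \<Rightarrow> real" where
  "dist_bool p q = of_bool (p \<noteq> q)"

definition uniformity_bool :: "(bool \<times> bool) filter" where
  "uniformity_bool = (INF e\<in>{0<..}. principal {(p, q). dist p q < e})"

instance
proof
  fix U :: "bool set"
  have "eventually (\<lambda>(p', q). p' = p \<longrightarrow> q \<in> U) uniformity" if "p \<in> U" for p
    unfolding uniformity_bool_def using that
    by (intro eventually_INF1[of 1]) (auto simp: eventually_principal dist_bool_def)
  then show "open U \<longleftrightarrow> (\<forall>p\<in>U. \<forall>\<^sub>F (p', q) in uniformity. p' = p \<longrightarrow> q \<in> U)"
    by (simp add: open_discrete)
qed (auto simp: dist_bool_def uniformity_bool_def)

end

lemma tendsto_fun_if_eventually_eq: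
  fixes f :: "'a \<Rightarrow> 'i \<Rightarrow> 'b::topological_space"
  assumes "\<And>i. eventually (\<lambda>n. f n i = l i) F"
  shows "(f \<longlongrightarrow> l) F"
proof -
  have "limitin (product_topology (\<lambda>i::'i. euclidean :: 'b topology) UNIV) f l F"
    using assms by (auto simp: limitin_componentwise intro: tendsto_eventually)
  then show ?thesis by (simp add: euclidean_product_topology)
qed

lemma completely_metrizable_discrete_fun:
  "completely_metrizable_space (euclidean :: ('i::countable \<Rightarrow> 'a::discrete_topology) topology)"
proof -
  have "(euclidean :: 'a topology) = discrete_topology UNIV"
    by (auto simp: topology_eq open_discrete simp flip: open_openin)
  then have "completely_metrizable_space (euclidean :: 'a topology)"
    by (simp add: completely_metrizable_space_discrete_topology)
  then show ?thesis
    unfolding euclidean_product_topology[symmetric] completely_metrizable_space_product_topology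
    by auto
qed

definition baire_analytic :: "'a::topological_space set \<Rightarrow> bool" where
  "baire_analytic S \<longleftrightarrow>
     (\<exists>(K :: (nat \<Rightarrow> nat) set) f. closed K \<and> continuous_on K f \<and> f ` K = S)"

lemma baire_analyticI:
  fixes K :: "(nat \<Rightarrow> nat) set"
  shows "closed K \<Longrightarrow> continuous_on K f \<Longrightarrow> f ` K = S \<Longrightarrow> baire_analytic S"
  unfolding baire_analytic_def by blast

lemma baire_analyticE:
  assumes "baire_analytic S"
  obtains K :: "(nat \<Rightarrow> nat) set" and f where "closed K" "continuous_on K f" "f ` K = S"
  using assms unfolding baire_analytic_def by blast

lemma baire_analytic_image:
  assumes "baire_analytic S" "continuous_on S g"
  shows "baire_analytic (g ` S)"
  using assms(1)
proof (rule baire_analyticE)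
  fix K :: "(nat \<Rightarrow> nat) set" and f assume "closed K" "continuous_on K f" "f ` K = S"
  then show ?thesis
    using assms(2) by (intro baire_analyticI[of K "g \<circ> f"]) (auto intro: continuous_on_compose2)
qed

lemma baire_analytic_Int_closed:
  assumes "baire_analytic S" "closed C"
  shows "baire_analytic (S \<inter> C)"
  using assms(1)
proof (rule baire_analyticE)
  fix K :: "(nat \<Rightarrow> nat) set" and f assume "closed K" "continuous_on K f" "f ` K = S"
  then show ?thesis
    using assms(2) by (intro baire_analyticI[of "K \<inter> f -` C" f])
      (auto intro: continuous_closed_preimage continuous_on_subset)
qed

lemma continuous_on_coordinate: "continuous_on S (\<lambda>x :: 'i \<Rightarrow> 'a::topological_space. x i)"
  by (rule continuous_on_subset[OF continuous_on_product_coordinates]) simp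

lemma continuous_on_reindex:
  "continuous_on S (\<lambda>(z :: 'i \<Rightarrow> 'a::topological_space) k. z (h k))"
  by (intro continuous_on_coordinatewise_then_product continuous_on_coordinate)

lemma baire_analytic_countable_product:
  fixes S :: "nat \<Rightarrow> 'a::topological_space set"
  assumes "\<And>n. baire_analytic (S n)"
  shows "baire_analytic {x. \<forall>n. x n \<in> S n}"
proof -
  obtain K :: "nat \<Rightarrow> (nat \<Rightarrow> nat) set" and f
    where K: "\<And>n. closed (K n)" "\<And>n. continuous_on (K n) (f n)" "\<And>n. f n ` K n = S n"
    using assms unfolding baire_analytic_def by metis
  define row where "row n z = (\<lambda>k. z (prod_encode (n, k)))" for n and z :: "nat \<Rightarrow> nat"
  have row: "continuous_on L (row n)" for L n
    unfolding row_def by (rule continuous_on_reindex)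
  let ?L = "{z. \<forall>n. row n z \<in> K n}" and ?F = "\<lambda>z n. f n (row n z)"
  show ?thesis
  proof (rule baire_analyticI)
    have "?L = (\<Inter>n. row n -` K n)" by auto
    then show "closed ?L" by (simp add: closed_INT closed_vimage K(1) row)
    have "continuous_on ?L (\<lambda>z. f n (row n z))" for n
      by (rule continuous_on_compose2[OF K(2) row]) auto
    then show "continuous_on ?L ?F" by (rule continuous_on_coordinatewise_then_product)
    show "?F ` ?L = {x. \<forall>n. x n \<in> S n}"
    proof (intro equalityI subsetI)
      fix x assume "x \<in> {x. \<forall>n. x n \<in> S n}"
      then have "x n \<in> f n ` K n" for n by (simp add: K(3))
      then have "\<exists>w. w \<in> K n \<and> f n w = x n" for n by (metis imageE)
      then obtain w where w: "\<And>n. w n \<in> K n" "\<And>n. f n (w n) = x n" by metis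
      have "row n (\<lambda>m. case prod_decode m of (i, k) \<Rightarrow> w i k) = w n" for n
        by (simp add: row_def)
      with w show "x \<in> ?F ` ?L"
        by (intro image_eqI[of _ _ "\<lambda>m. case prod_decode m of (i, k) \<Rightarrow> w i k"]) auto
    qed (use K(3) in auto)
  qed
qed

lemma baire_analytic_INT:
  fixes S :: "nat \<Rightarrow> 'a::t2_space set"
  assumes "\<And>n. baire_analytic (S n)"
  shows "baire_analytic (\<Inter>n. S n)"
proof -
  let ?D = "{x :: nat \<Rightarrow> 'a. \<forall>n. x n = x 0}"
  have "closed ?D"
    by (intro closed_Collect_all closed_Collect_eq continuous_on_coordinate)
  then have "baire_analytic ((\<lambda>x. x 0) ` ({x. \<forall>n. x n \<in> S n} \<inter> ?D))"
    by (intro baire_analytic_image baire_analytic_Int_closed baire_analytic_countable_product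
        assms continuous_on_coordinate)
  also have "(\<lambda>x. x 0) ` ({x. \<forall>n. x n \<in> S n} \<inter> ?D) = (\<Inter>n. S n)"
  proof (intro equalityI subsetI)
    fix a assume "a \<in> (\<Inter>n. S n)"
    then show "a \<in> (\<lambda>x. x 0) ` ({x. \<forall>n. x n \<in> S n} \<inter> ?D)"
      by (intro image_eqI[of _ _ "\<lambda>n. a"]) auto
  qed (clarsimp, metis)
  finally show ?thesis .
qed

lemma closed_Collect_tail_mem:
  fixes C :: "nat \<Rightarrow> (nat \<Rightarrow> nat) set"
  assumes "\<And>n. closed (C n)"
  shows "closed {z. (\<lambda>k. z (Suc k)) \<in> C (z 0)}"
proof -
  have "- {z. (\<lambda>k. z (Suc k)) \<in> C (z 0)} =
      (\<Union>n. (\<lambda>z. z 0) -` {n} \<inter> (\<lambda>z k. z (Suc k)) -` (- C n))"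
    by auto
  also have "open \<dots>"
    using assms by (intro open_UN ballI open_Int open_vimage open_discrete open_Compl
        continuous_on_coordinate continuous_on_reindex)
  finally show ?thesis by (simp add: closed_def)
qed

lemma baire_analytic_UN:
  fixes S :: "nat \<Rightarrow> 'a::topological_space set"
  assumes "\<And>n. baire_analytic (S n)"
  shows "baire_analytic (\<Union>n. S n)"
proof -
  obtain K :: "nat \<Rightarrow> (nat \<Rightarrow> nat) set" and f
    where K: "\<And>n. closed (K n)" "\<And>n. continuous_on (K n) (f n)" "\<And>n. f n ` K n = S n"
    using assms unfolding baire_analytic_def by metis
  define tail where "tail z = (\<lambda>k. z (Suc k))" for z :: "nat \<Rightarrow> nat"
  have closed_tail: "closed {z. tail z \<in> C (z 0)}" if "\<And>n. closed (C n)" for C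
    unfolding tail_def using that by (rule closed_Collect_tail_mem)
  let ?L = "{z. tail z \<in> K (z 0)}" and ?F = "\<lambda>z. f (z 0) (tail z)"
  show ?thesis
  proof (rule baire_analyticI)
    show "closed ?L" by (rule closed_tail) (rule K(1))
    show "continuous_on ?L ?F"
      unfolding continuous_on_closed_vimage[OF \<open>closed ?L\<close>]
    proof (intro allI impI)
      fix B :: "'a set" assume "closed B"
      then have "closed (K n \<inter> f n -` B)" for n using K by (intro continuous_closed_preimage)
      then have "closed {z. tail z \<in> K (z 0) \<inter> f (z 0) -` B}"
        by (rule closed_tail[of "\<lambda>n. K n \<inter> f n -` B"])
      moreover have "?F -` B \<inter> ?L = {z. tail z \<in> K (z 0) \<inter> f (z 0) -` B}" by auto
      ultimately show "closed (?F -` B \<inter> ?L)" by simp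
    qed
    show "?F ` ?L = (\<Union>n. S n)"
    proof (intro equalityI subsetI)
      fix a assume "a \<in> (\<Union>n. S n)"
      then obtain n w where "w \<in> K n" "a = f n w" using K(3) by blast
      then show "a \<in> ?F ` ?L"
        by (intro image_eqI[of _ _ "case_nat n w"]) (simp_all add: tail_def)
    qed (use K(3) in auto)
  qed
qed

lemma baire_analytic_open:
  fixes U :: "'a::topological_space set"
  assumes "baire_analytic (UNIV :: 'a set)" "open U"
  shows "baire_analytic U"
  using assms(1)
proof (rule baire_analyticE)
  fix K :: "(nat \<Rightarrow> nat) set" and f :: "_ \<Rightarrow> 'a"
  assume K: "closed K" "continuous_on K f" "f ` K = UNIV"
  obtain V where V: "open V" "V \<inter> K = f -` U \<inter> K"
    using K(2) assms(2) unfolding continuous_on_open_invariant by metis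
  have "fsigma_in euclidean V"
    using V(1) completely_metrizable_discrete_fun
    by (intro open_imp_fsigma_in completely_metrizable_imp_metrizable_space) auto
  then obtain C where C: "\<And>n. closed (C n)" "V = (\<Union>n :: nat. C n)"
    unfolding fsigma_in_ascending closed_closedin by metis
  have "baire_analytic (f ` (K \<inter> C n))" for n
    using K C(1) by (intro baire_analyticI[of "K \<inter> C n"]) (auto intro: continuous_on_subset)
  then have "baire_analytic (\<Union>n. f ` (K \<inter> C n))" by (rule baire_analytic_UN)
  also have "(\<Union>n. f ` (K \<inter> C n)) = f ` (V \<inter> K)" unfolding C(2) by blast
  also have "\<dots> = U \<inter> f ` K" unfolding V(2) by auto
  also have "\<dots> = U" by (simp add: K(3))
  finally show ?thesis .
qed

lemma baire_analytic_borel: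
  fixes S :: "'a::t2_space set"
  assumes UNIV: "baire_analytic (UNIV :: 'a set)" and "S \<in> sets borel"
  shows "baire_analytic S"
proof -
  have "S \<in> sigma_sets UNIV {U. open U}" using assms(2) by (simp add: borel_def)
  then have "baire_analytic S \<and> baire_analytic (- S)"
  proof induction
    case (Basic U)
    then show ?case
      using baire_analytic_open[OF UNIV] baire_analytic_Int_closed[OF UNIV, of "- U"] by auto
  next
    case Empty
    show ?case using UNIV baire_analytic_open[OF UNIV] by auto
  next
    case (Compl S)
    then show ?case by (simp add: Compl_eq_Diff_UNIV[symmetric])
  next
    case (Union S)
    then show ?case using baire_analytic_UN[of S] baire_analytic_INT[of "\<lambda>n. - S n"] by simp
  qed
  then show ?thesis ..
qed

lemma baire_analytic_UNIV_discrete_fun: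
  "baire_analytic (UNIV :: ('i::countable \<Rightarrow> 'a::{countable, discrete_topology}) set)"
proof (rule baire_analyticI)
  let ?f = "\<lambda>(z :: nat \<Rightarrow> nat) i. from_nat (z (to_nat (i :: 'i))) :: 'a"
  show "continuous_on UNIV ?f"
    by (intro continuous_on_coordinatewise_then_product
        continuous_on_compose2[OF Topological_Spaces.continuous_on_discrete[of UNIV]
          continuous_on_coordinate]) simp
  show "?f ` UNIV = UNIV"
  proof (intro equalityI subsetI)
    fix a :: "'i \<Rightarrow> 'a"
    show "a \<in> ?f ` UNIV"
      by (intro image_eqI[of _ _ "\<lambda>n. to_nat (a (from_nat n))"]) auto
  qed simp
qed simp

lemma baire_analytic_UNIV_square:
  assumes "baire_analytic (UNIV :: 'a::topological_space set)"
  shows "baire_analytic (UNIV :: ('a \<times> 'a) set)"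
proof -
  have "baire_analytic ((\<lambda>x. (x 0, x 1)) ` {x :: nat \<Rightarrow> 'a. \<forall>n. x n \<in> UNIV})"
    by (intro baire_analytic_image baire_analytic_countable_product assms continuous_on_Pair
        continuous_on_coordinate)
  also have "(\<lambda>x. (x 0, x 1)) ` {x :: nat \<Rightarrow> 'a. \<forall>n. x n \<in> UNIV} = UNIV"
  proof (intro equalityI subsetI)
    fix p :: "'a \<times> 'a"
    show "p \<in> (\<lambda>x. (x 0, x 1)) ` {x :: nat \<Rightarrow> 'a. \<forall>n. x n \<in> UNIV}"
      by (intro image_eqI[of _ _ "case_nat (fst p) (\<lambda>n. snd p)"]) auto
  qed simp
  finally show ?thesis .
qed

lemma baire_analytic_not_acc:
  fixes R :: "'a::t2_space rel"
  assumes "baire_analytic R"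
  shows "baire_analytic (- Wellfounded.acc R)"
proof -
  let ?C = "{p :: nat \<Rightarrow> 'a \<times> 'a. \<forall>n. fst (p n) = snd (p (Suc n))}"
  have "closed ?C"
    by (intro closed_Collect_all closed_Collect_eq continuous_on_fst continuous_on_snd
        continuous_on_coordinate)
  then have "baire_analytic ((\<lambda>p. snd (p 0)) ` ({p. \<forall>n. p n \<in> R} \<inter> ?C))"
    by (intro baire_analytic_image baire_analytic_Int_closed baire_analytic_countable_product
        assms continuous_on_snd continuous_on_coordinate)
  also have "(\<lambda>p. snd (p 0)) ` ({p. \<forall>n. p n \<in> R} \<inter> ?C) = - Wellfounded.acc R"
  proof (intro equalityI subsetI)
    fix x assume "x \<in> (\<lambda>p. snd (p 0)) ` ({p. \<forall>n. p n \<in> R} \<inter> ?C)"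
    then obtain p where p: "x = snd (p 0)" "\<And>n. p n \<in> R" "\<And>n. fst (p n) = snd (p (Suc n))"
      by auto
    then have "(snd (p (Suc n)), snd (p n)) \<in> R" for n by (metis prod.collapse)
    with p(1) show "x \<in> - Wellfounded.acc R"
      unfolding Compl_iff not_acc_iff_descending_chain
      by (intro exI[of _ "\<lambda>n. snd (p n)"]) auto
  next
    fix x assume "x \<in> - Wellfounded.acc R"
    then obtain c where "c 0 = x" "\<And>n. (c (Suc n), c n) \<in> R"
      by (auto simp: not_acc_iff_descending_chain)
    then show "x \<in> (\<lambda>p. snd (p 0)) ` ({p. \<forall>n. p n \<in> R} \<inter> ?C)"
      by (intro image_eqI[of _ _ "\<lambda>n. (c (Suc n), c n)"]) auto
  qed
  finally show ?thesis .
qed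

section \<open>Polish topologies on sets of reals\<close>

lemma polish_topology_copy_on_real:
  fixes X :: "'a topology" and h :: "'a \<Rightarrow> real"
  assumes X: "polish_topology X" and inj: "inj_on h (topspace X)"
  obtains Y :: "real topology" and g where "polish_topology Y" "continuous_map Y X g"
    "g ` topspace Y = topspace X"
proof
  let ?g = "inv_into (topspace X) h"
  let ?Y = "pullback_topology (h ` topspace X) ?g X"
  have top: "topspace ?Y = h ` topspace X"
    using inj by (auto simp: topspace_pullback_topology inv_into_into)
  have g: "continuous_map ?Y X ?g"
    using continuous_map_pullback[OF continuous_map_id, of _ ?g X] by simp
  have "continuous_map X ?Y h"
    using inj
    by (intro continuous_map_pullback') (auto intro: continuous_map_eq[OF continuous_map_id])
  then have "homeomorphic_maps X ?Y h ?g"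
    using inj g by (auto simp: homeomorphic_maps_def top f_inv_into_f)
  then have "X homeomorphic_space ?Y" unfolding homeomorphic_space_def by blast
  then show "polish_topology ?Y"
    using X homeomorphic_completely_metrizable_space homeomorphic_separable_space
    unfolding polish_topology_def by blast
  show "?g ` topspace ?Y = topspace X" using inj by (force simp: top)
  show "continuous_map ?Y X ?g" by fact
qed

lemma second_countable_euclidean:
  "second_countable (euclidean :: 'a::second_countable_topology topology)"
proof -
  obtain B :: "'a set set" where B: "countable B" "topological_basis B"
    using ex_countable_basis by blast
  then show ?thesis unfolding second_countable_def
    by (metis open_openin topological_basisE topological_basis_open)
qed

lemma polish_topology_closed_discrete_fun:
  fixes K :: "('i::countable \<Rightarrow> 'a::{discrete_topology, second_countable_topology}) set"
  shows "closed K \<Longrightarrow> polish_topology (top_of_set K)"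
  unfolding polish_topology_def
  by (auto intro!: completely_metrizable_space_closedin completely_metrizable_discrete_fun
      second_countable_imp_separable_space second_countable_subtopology second_countable_euclidean)

lemma inj_baire_real: "\<exists>h :: (nat \<Rightarrow> nat) \<Rightarrow> real. inj h"
proof -
  have "inj (\<lambda>z :: nat \<Rightarrow> nat. range (\<lambda>n. prod_encode (n, z n)))"
  proof (rule injI, rule ext)
    fix z w :: "nat \<Rightarrow> nat" and n
    assume "range (\<lambda>n. prod_encode (n, z n)) = range (\<lambda>n. prod_encode (n, w n))"
    then have "prod_encode (n, z n) \<in> range (\<lambda>n. prod_encode (n, w n))" by blast
    then show "z n = w n" by auto
  qed
  moreover obtain e :: "nat set \<Rightarrow> real" where "inj e"
    using nat_sets_eqpoll_reals by (auto simp: eqpoll_def bij_betw_def)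
  ultimately show ?thesis using inj_compose by blast
qed

lemma analytic_set_if_baire_analytic:
  assumes "baire_analytic S"
  shows "analytic_set S"
  using assms
proof (rule baire_analyticE)
  fix K :: "(nat \<Rightarrow> nat) set" and f assume K: "closed K" "continuous_on K f" "f ` K = S"
  obtain h :: "(nat \<Rightarrow> nat) \<Rightarrow> real" where "inj h" using inj_baire_real by blast
  then have "inj_on h (topspace (top_of_set K))" by (rule inj_on_subset) simp
  with polish_topology_closed_discrete_fun[OF K(1)]
  obtain Y :: "real topology" and g where Y: "polish_topology Y" "continuous_map Y (top_of_set K) g"
      "g ` topspace Y = topspace (top_of_set K)"
    by (rule polish_topology_copy_on_real)
  have "continuous_map Y euclidean (f \<circ> g)"
    using Y(2) K(2) by (intro continuous_map_compose) auto
  moreover have "(f \<circ> g) ` topspace Y = S" unfolding image_comp[symmetric] using Y(3) K(3) by simp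
  ultimately show ?thesis unfolding analytic_set_def using Y(1) by blast
qed

section \<open>The Kunen--Martin theorem\<close>

text \<open>A list \<open>[z\<^sub>n, \<dots>, z\<^sub>0]\<close> of codes with \<open>f z\<^sub>i = (x\<^sub>i\<^sub>+\<^sub>1, x\<^sub>i)\<close> stands for the descending
  sequence \<open>x\<^sub>0, \<dots>, x\<^sub>n\<^sub>+\<^sub>1\<close>. There are only countably many truncations, yet along an infinite chain of
  truncated extensions each \<open>z\<^sub>i\<close> stabilises coordinatewise, so that closedness of \<open>K\<close> yields an
  infinite descending sequence of points.\<close>

definition descents :: "'z set \<Rightarrow> ('z \<Rightarrow> 'x \<times> 'x) \<Rightarrow> 'z list set" where
  "descents K f = {s. set s \<subseteq> K \<and> successively (\<lambda>w z. snd (f w) = fst (f z)) s}"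

definition truncation :: "(nat \<Rightarrow> 'a) list \<Rightarrow> 'a list list" where
  "truncation s = map (\<lambda>z. map z [0..<length s]) s"

definition truncated_extension ::
    "(nat \<Rightarrow> 'a) set \<Rightarrow> ((nat \<Rightarrow> 'a) \<Rightarrow> 'x \<times> 'x) \<Rightarrow> 'a list list rel" where
  "truncated_extension K f = {(truncation (z # s), truncation s) |z s. z # s \<in> descents K f}"

lemma length_truncation [simp]: "length (truncation s) = length s"
  by (simp add: truncation_def)

lemma truncation_eq_nth:
  assumes "truncation s = truncation t" "i < length s" "m < length s"
  shows "(s ! i) m = (t ! i) m"
proof -
  have length: "length t = length s" using assms(1) by (metis length_truncation)
  have "truncation s ! i ! m = truncation t ! i ! m" using assms(1) by simp
  then show ?thesis using assms(2,3) length by (simp add: truncation_def)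
qed

lemma eventually_constant_coordinates_convergent:
  fixes z :: "nat \<Rightarrow> nat \<Rightarrow> 'a::topological_space"
  assumes "\<And>k m. N \<le> k \<Longrightarrow> m \<le> k \<Longrightarrow> z (Suc k) m = z k m"
  shows "convergent z"
proof (rule convergentI)
  show "z \<longlonglongrightarrow> (\<lambda>m. z (max N m) m)"
  proof (rule tendsto_fun_if_eventually_eq)
    fix m
    have "z k m = z (max N m) m" if "max N m \<le> k" for k
      using that by (induction k rule: dec_induct) (simp_all add: assms)
    then show "\<forall>\<^sub>F k in sequentially. z k m = z (max N m) m"
      unfolding eventually_sequentially by blast
  qed
qed

lemma descents_rev_nth:
  assumes "s \<in> descents K f"
  shows "i < length s \<Longrightarrow> rev s ! i \<in> K"
    and "Suc i < length s \<Longrightarrow> snd (f (rev s ! Suc i)) = fst (f (rev s ! i))"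
proof -
  have "successively (\<lambda>z w. snd (f w) = fst (f z)) (rev s)"
    using assms by (simp add: descents_def)
  then show "Suc i < length s \<Longrightarrow> snd (f (rev s ! Suc i)) = fst (f (rev s ! i))"
    by (simp add: successively_conv_nth)
  show "i < length s \<Longrightarrow> rev s ! i \<in> K"
    using assms nth_mem[of i "rev s"] by (auto simp: descents_def)
qed

lemma descending_chain_if_convergent:
  fixes f :: "'z::topological_space \<Rightarrow> 'x::t2_space \<times> 'x"
  assumes K: "closed K" "continuous_on K f"
    and mem: "\<And>i. \<forall>\<^sub>F k in sequentially. z k i \<in> K"
    and linked: "\<And>i. \<forall>\<^sub>F k in sequentially. snd (f (z k (Suc i))) = fst (f (z k i))"
    and lim: "\<And>i. (\<lambda>k. z k i) \<longlonglongrightarrow> l i"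
  shows "\<not> wf (f ` K)"
proof -
  have l: "l i \<in> K" for i
    using Lim_in_closed_set[OF K(1) mem _ lim] by simp
  have f_lim: "(\<lambda>k. f (z k i)) \<longlonglongrightarrow> f (l i)" for i
    by (rule continuous_on_tendsto_compose[OF K(2) lim l mem])
  have "snd (f (l (Suc i))) = fst (f (l i))" for i
  proof (rule tendsto_unique[OF sequentially_bot])
    show "(\<lambda>k. fst (f (z k i))) \<longlonglongrightarrow> fst (f (l i))" by (intro tendsto_fst f_lim)
    show "(\<lambda>k. fst (f (z k i))) \<longlonglongrightarrow> snd (f (l (Suc i)))"
      using tendsto_snd[OF f_lim, of "Suc i"] by (rule Lim_transform_eventually) (rule linked)
  qed
  then have "(snd (f (l (Suc i))), snd (f (l i))) \<in> f ` K" for i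
    using l by (intro image_eqI[of _ _ "l i"]) (simp_all add: prod_eq_iff)
  then show ?thesis
    unfolding wf_iff_no_infinite_down_chain by (auto intro!: exI[of _ "\<lambda>i. snd (f (l i))"])
qed

lemma truncation_chain_convergent:
  fixes s :: "nat \<Rightarrow> (nat \<Rightarrow> 'a::topological_space) list"
  assumes "\<And>k. \<exists>w. truncation (s (Suc k)) = truncation (w # s k)"
  shows "k \<le> length (s k)" and "convergent (\<lambda>k. rev (s k) ! i)"
proof -
  have length_Suc: "length (s (Suc k)) = Suc (length (s k))" for k
    using assms[of k] by (metis length_Cons length_truncation)
  show length: "k \<le> length (s k)" for k
    by (induction k) (simp_all add: length_Suc)
  have stable: "(rev (s (Suc k)) ! i) m = (rev (s k) ! i) m"
    if "i < length (s k)" "m \<le> length (s k)" for k i m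
  proof -
    obtain w where "truncation (s (Suc k)) = truncation (w # s k)" using assms by blast
    from truncation_eq_nth[OF this, of "length (s k) - i" m] that show ?thesis
      by (simp add: rev_nth length_Suc Suc_diff_le)
  qed
  show "convergent (\<lambda>k. rev (s k) ! i)"
  proof (rule eventually_constant_coordinates_convergent)
    fix k m assume "Suc i \<le> k" "m \<le> k"
    then show "(rev (s (Suc k)) ! i) m = (rev (s k) ! i) m"
      using length[of k] by (intro stable) auto
  qed
qed

lemma wf_truncated_extension:
  fixes K :: "(nat \<Rightarrow> 'a::topological_space) set" and f :: "_ \<Rightarrow> 'x::t2_space \<times> 'x"
  assumes K: "closed K" "continuous_on K f" and wf: "wf (f ` K)"
  shows "wf (truncated_extension K f)"
proof (rule ccontr)
  assume "\<not> ?thesis"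
  then obtain c where "\<And>k. (c (Suc k), c k) \<in> truncated_extension K f"
    unfolding wf_iff_no_infinite_down_chain by blast
  then have "\<exists>w s. c (Suc k) = truncation (w # s) \<and> c k = truncation s \<and> w # s \<in> descents K f" for k
    unfolding truncated_extension_def by blast
  then obtain w s where c_Suc: "\<And>k. c (Suc k) = truncation (w k # s k)"
    and c_eq: "\<And>k. c k = truncation (s k)" and extended: "\<And>k. w k # s k \<in> descents K f"
    by metis
  have descents: "s k \<in> descents K f" for k
    using extended[of k] by (auto simp: descents_def successively_Cons)
  have "\<exists>w. truncation (s (Suc k)) = truncation (w # s k)" for k using c_Suc c_eq by metis
  note chain = truncation_chain_convergent[of s, OF this]
  obtain l where "\<And>i. (\<lambda>k. rev (s k) ! i) \<longlonglongrightarrow> l i"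
    using chain(2) unfolding convergent_def by metis
  moreover have long: "\<forall>\<^sub>F k in sequentially. i < length (s k)" for i
    unfolding eventually_sequentially using chain(1) less_le_trans by (metis Suc_le_eq)
  then have "\<forall>\<^sub>F k in sequentially. rev (s k) ! i \<in> K" for i
    by (rule eventually_mono) (rule descents_rev_nth[OF descents])
  moreover have
    "\<forall>\<^sub>F k in sequentially. snd (f (rev (s k) ! Suc i)) = fst (f (rev (s k) ! i))" for i
    using long[of "Suc i"] by (rule eventually_mono) (rule descents_rev_nth[OF descents])
  ultimately have "\<not> wf (f ` K)"
    using descending_chain_if_convergent[OF K, of "\<lambda>k i. rev (s k) ! i" l] by blast
  with wf show False by contradiction
qed

text \<open>The rank of a point is the least rank of a descent that ends in it.\<close>

lemma countable_rank_if_descents_ranked: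
  assumes W: "wf W" "countable W"
    and descents: "\<And>z s. z # s \<in> descents K f \<Longrightarrow> (\<kappa> (z # s), \<kappa> s) \<in> W"
  shows "countable_rank (f ` K)"
proof -
  obtain r :: "nat rel" and \<rho> where r: "Well_order r" "Field r = UNIV"
    and \<rho>: "\<And>x y. (x, y) \<in> W \<Longrightarrow> (\<rho> x, \<rho> y) \<in> r - Id"
    using countable_rank_if_countable[OF W] by (rule countable_rankE) blast
  have wf: "wf (r - Id)" and linear: "Linear_order r"
    using r(1) by (simp_all add: well_order_on_def)
  define D where "D x = {s \<in> descents K f. s \<noteq> [] \<longrightarrow> fst (f (hd s)) = x}" for x
  define N where "N x = (\<lambda>s. \<rho> (\<kappa> s)) ` D x" for x
  have "\<exists>n\<in>N x. \<forall>m. (m, n) \<in> r - Id \<longrightarrow> m \<notin> N x" for x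
  proof (rule wfE_min'[OF wf])
    have "[] \<in> D x" by (simp add: D_def descents_def)
    then show "N x \<noteq> {}" unfolding N_def by blast
  qed blast
  then obtain \<sigma> where \<sigma>: "\<And>x. \<sigma> x \<in> N x"
    and minimal: "\<And>x m. (m, \<sigma> x) \<in> r - Id \<Longrightarrow> m \<notin> N x"
    by metis
  have "(\<sigma> x, \<sigma> y) \<in> r - Id" if xy: "(x, y) \<in> f ` K" for x y
  proof -
    obtain z where z: "z \<in> K" "f z = (x, y)" using xy by (metis imageE)
    obtain s where s: "s \<in> D y" "\<sigma> y = \<rho> (\<kappa> s)" using \<sigma>[of y] by (auto simp: N_def)
    have zs: "z # s \<in> descents K f" "z # s \<in> D x"
      using z s by (auto simp: D_def descents_def successively_Cons)
    have less: "(\<rho> (\<kappa> (z # s)), \<sigma> y) \<in> r - Id"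
      unfolding s(2) by (intro \<rho> descents zs(1))
    have "(\<rho> (\<kappa> (z # s)), \<sigma> x) \<notin> r - Id"
      using minimal zs(2) unfolding N_def by blast
    then have "(\<sigma> x, \<rho> (\<kappa> (z # s))) \<in> r"
      using linear r(2) by (cases "\<sigma> x = \<rho> (\<kappa> (z # s))")
        (auto simp: order_on_defs total_on_def refl_on_def)
    with less show ?thesis
      using linear by (auto simp: order_on_defs dest: transD antisymD)
  qed
  with r show ?thesis unfolding countable_rank_def by blast
qed

theorem kunen_martin:
  fixes R :: "'a::t2_space rel"
  assumes "wf R" "baire_analytic R"
  shows "countable_rank R"
  using assms(2)
proof (rule baire_analyticE)
  fix K :: "(nat \<Rightarrow> nat) set" and f assume K: "closed K" "continuous_on K f" "f ` K = R"
  have "wf (truncated_extension K f)"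
    using K assms(1) by (intro wf_truncated_extension) simp_all
  moreover have "z # s \<in> descents K f \<Longrightarrow>
      (truncation (z # s), truncation s) \<in> truncated_extension K f" for z s
    by (auto simp: truncated_extension_def)
  ultimately have "countable_rank (f ` K)" by (intro countable_rank_if_descents_ranked) auto
  with K(3) show ?thesis by simp
qed

section \<open>The fixed point of the operation\<close>

lemma tau_op_mono: "\<F> \<subseteq> \<G> \<Longrightarrow> tau_op \<F> \<subseteq> tau_op \<G>"
  by (auto simp: tau_op_def)

definition meet_translates :: "'g \<Rightarrow> 'g \<Rightarrow> 'g::group_add set \<Rightarrow> 'g set" where
  "meet_translates x y A = (+) x ` A \<inter> (+) y ` A"

definition tau_descent :: "'g::group_add set set \<Rightarrow> 'g set rel" where
  "tau_descent \<F> = {(B, A). B \<notin> \<F> \<and> (\<exists>x y. x \<noteq> y \<and> B = meet_translates x y A)}"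

lemma mem_tau_op_iff_tau_descent:
  assumes "\<F> \<subseteq> H"
  shows "A \<in> tau_op H \<longleftrightarrow> (\<forall>B. (B, A) \<in> tau_descent \<F> \<longrightarrow> B \<in> H)"
  using assms by (auto simp: tau_op_def tau_descent_def meet_translates_def)

lemma no_tau_descent_from_base:
  assumes "left_invariant_family \<F>" "lower_family \<F>" "A \<in> \<F>"
  shows "(B, A) \<notin> tau_descent \<F>"
  using assms
  unfolding tau_descent_def meet_translates_def left_invariant_family_def lower_family_def
  by (auto, meson Int_lower1)

lemma tau_op_increasing:
  assumes "left_invariant_family \<F>" "lower_family \<F>"
  shows "\<F> \<subseteq> tau_op \<F>"
  using no_tau_descent_from_base[OF assms] by (auto simp: mem_tau_op_iff_tau_descent[of \<F>])

lemma base_subset_acc_tau_descent: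
  assumes "left_invariant_family \<F>" "lower_family \<F>"
  shows "\<F> \<subseteq> Wellfounded.acc (tau_descent \<F>)"
  using no_tau_descent_from_base[OF assms] by (blast intro: accI)

lemma tau_op_acc_tau_descent:
  assumes "left_invariant_family \<F>" "lower_family \<F>"
  shows "tau_op (Wellfounded.acc (tau_descent \<F>)) = Wellfounded.acc (tau_descent \<F>)"
  using mem_tau_op_iff_tau_descent[OF base_subset_acc_tau_descent[OF assms]]
  by (auto intro: accI dest: acc_downward)

lemma acc_tau_descent_subset_fixpoint:
  assumes "\<F> \<subseteq> H" "tau_op H = H"
  shows "Wellfounded.acc (tau_descent \<F>) \<subseteq> H"
proof
  fix A assume "A \<in> Wellfounded.acc (tau_descent \<F>)"
  then show "A \<in> H"
    by induction (use mem_tau_op_iff_tau_descent[OF assms(1)] assms(2) in blast)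
qed

lemma tau_star_eq_acc_tau_descent:
  assumes "left_invariant_family \<F>" "lower_family \<F>"
  shows "tau_star \<F> = Wellfounded.acc (tau_descent \<F>)"
  unfolding tau_star_def
proof (rule the_equality)
  let ?acc = "Wellfounded.acc (tau_descent \<F>)"
  show least: "\<F> \<subseteq> ?acc \<and> tau_op ?acc = ?acc \<and> (\<forall>H. \<F> \<subseteq> H \<and> tau_op H = H \<longrightarrow> ?acc \<subseteq> H)"
    using base_subset_acc_tau_descent[OF assms] tau_op_acc_tau_descent[OF assms]
      acc_tau_descent_subset_fixpoint by blast
  show "H = ?acc"
    if "\<F> \<subseteq> H \<and> tau_op H = H \<and> (\<forall>H'. \<F> \<subseteq> H' \<and> tau_op H' = H' \<longrightarrow> H \<subseteq> H')" for H
    using that least by (intro equalityI) simp_all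
qed

section \<open>The iterates\<close>

lemma tau_level_unfold:
  assumes "wf (r - Id)"
  shows "tau_level r \<F> a =
    (if underS r a = {} then \<F> else tau_op (\<Union>b\<in>underS r a. tau_level r \<F> b))"
proof -
  have "(\<Union>b\<in>underS r a. cut (tau_level r \<F>) (r - Id) a b) = (\<Union>b\<in>underS r a. tau_level r \<F> b)"
    by (auto simp: cut_apply underS_def)
  then show ?thesis
    unfolding tau_level_def by (subst wfrec[OF assms]) simp
qed

lemma tau_level_induct:
  assumes "wf (r - Id)" and base: "P \<F>"
    and op: "\<And>B. B \<noteq> {} \<Longrightarrow> (\<And>b. b \<in> B \<Longrightarrow> P (tau_level r \<F> b)) \<Longrightarrow>
        P (tau_op (\<Union>b\<in>B. tau_level r \<F> b))"
  shows "P (tau_level r \<F> a)"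
proof (induction a rule: wf_induct_rule[OF assms(1), case_names less])
  case (less a)
  show ?case
    unfolding tau_level_unfold[OF assms(1), of \<F> a]
    using base op[of "underS r a"] less by (auto simp: underS_def)
qed

lemma tau_ord_induct:
  assumes "Well_order r" and base: "P \<F>"
    and op: "\<And>B. B \<noteq> {} \<Longrightarrow> (\<And>b. b \<in> B \<Longrightarrow> P (tau_level r \<F> b)) \<Longrightarrow>
        P (tau_op (\<Union>b\<in>B. tau_level r \<F> b))"
  shows "P (tau_ord r \<F>)"
proof -
  have "wf (r - Id)" using assms(1) by (simp add: well_order_on_def)
  from tau_level_induct[of r P, OF this base op] show ?thesis
    using base op[of "Field r"] by (auto simp: tau_ord_def)
qed

lemma tau_op_tau_level_subset:
  assumes "wf (r - Id)" "(b, a) \<in> r - Id"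
  shows "tau_op (tau_level r \<F> b) \<subseteq> tau_level r \<F> a"
proof -
  have "b \<in> underS r a" using assms by (auto simp: underS_def)
  moreover from this have "tau_op (tau_level r \<F> b) \<subseteq> tau_op (\<Union>b\<in>underS r a. tau_level r \<F> b)"
    by (intro tau_op_mono) auto
  ultimately show ?thesis using tau_level_unfold[OF assms(1), of \<F> a] by auto
qed

lemma base_subset_tau_level:
  assumes "wf (r - Id)" "left_invariant_family \<F>" "lower_family \<F>"
  shows "\<F> \<subseteq> tau_level r \<F> a"
proof (rule tau_level_induct[where P = "\<lambda>\<G>. \<F> \<subseteq> \<G>", OF assms(1)])
  fix B assume "B \<noteq> {}" "\<And>b. b \<in> B \<Longrightarrow> \<F> \<subseteq> tau_level r \<F> b"
  then have "tau_op \<F> \<subseteq> tau_op (\<Union>b\<in>B. tau_level r \<F> b)" by (intro tau_op_mono) auto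
  then show "\<F> \<subseteq> tau_op (\<Union>b\<in>B. tau_level r \<F> b)"
    using tau_op_increasing[OF assms(2,3)] by blast
qed simp

lemma tau_ord_subset_fixpoint:
  assumes "Well_order r" "\<F> \<subseteq> H" "tau_op H = H"
  shows "tau_ord r \<F> \<subseteq> H"
proof (rule tau_ord_induct[where P = "\<lambda>\<G>. \<G> \<subseteq> H", OF assms(1,2)])
  fix B assume "\<And>b. b \<in> B \<Longrightarrow> tau_level r \<F> b \<subseteq> H"
  then have "tau_op (\<Union>b\<in>B. tau_level r \<F> b) \<subseteq> tau_op H" by (intro tau_op_mono) auto
  with assms(3) show "tau_op (\<Union>b\<in>B. tau_level r \<F> b) \<subseteq> H" by simp
qed

lemma tau_ord_subset_acc_tau_descent:
  assumes "Well_order r" "left_invariant_family \<F>" "lower_family \<F>"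
  shows "tau_ord r \<F> \<subseteq> Wellfounded.acc (tau_descent \<F>)"
  using assms by (intro tau_ord_subset_fixpoint base_subset_acc_tau_descent tau_op_acc_tau_descent)

lemma countable_rank_subset_tau_ord:
  fixes S :: "'g::group_add set set"
  assumes F: "left_invariant_family \<F>" "lower_family \<F>"
    and closed: "\<And>A B. (B, A) \<in> tau_descent \<F> \<Longrightarrow> A \<in> S \<Longrightarrow> B \<in> S"
    and rank: "countable_rank (Restr (tau_descent \<F>) S)"
  obtains r :: "nat rel" where "Well_order r" "S \<subseteq> tau_ord r \<F>"
proof -
  obtain r :: "nat rel" and \<rho> where r: "Well_order r" "Field r = UNIV"
    and \<rho>: "\<And>B A. (B, A) \<in> Restr (tau_descent \<F>) S \<Longrightarrow> (\<rho> B, \<rho> A) \<in> r - Id"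
    using rank by (rule countable_rankE) blast
  have wf: "wf (r - Id)" using r(1) by (simp add: well_order_on_def)
  have "A \<in> tau_op (tau_level r \<F> (\<rho> A))" if "A \<in> S" for A
    using that
  proof (induction "\<rho> A" arbitrary: A rule: wf_induct_rule[OF wf, case_names less])
    case (less A)
    have "B \<in> tau_level r \<F> (\<rho> A)" if "(B, A) \<in> tau_descent \<F>" for B
    proof -
      have "B \<in> S" "(\<rho> B, \<rho> A) \<in> r - Id" using closed \<rho> that less.prems by auto
      then show ?thesis using less.hyps tau_op_tau_level_subset[OF wf] by blast
    qed
    then show ?case
      by (simp add: mem_tau_op_iff_tau_descent[OF base_subset_tau_level[OF wf F]])
  qed
  moreover have "tau_op (tau_level r \<F> n) \<subseteq> tau_op (\<Union>n. tau_level r \<F> n)" for n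
    by (intro tau_op_mono) auto
  then have "tau_op (tau_level r \<F> n) \<subseteq> tau_ord r \<F>" for n
    using r(2) by (simp add: tau_ord_def)
  ultimately show thesis using r(1) that by blast
qed

lemma countable_tau_descent_predecessors:
  fixes \<F> :: "'g::{group_add, countable} set set"
  shows "countable {B. (B, A) \<in> tau_descent \<F>}"
proof (rule countable_subset)
  show "{B. (B, A) \<in> tau_descent \<F>} \<subseteq> range (\<lambda>(x, y). meet_translates x y A)"
    by (auto simp: tau_descent_def)
qed simp

lemma countable_descendants:
  assumes "\<And>y. countable {x. (x, y) \<in> R}"
  shows "countable {x. (x, y) \<in> R\<^sup>*}"
proof -
  have "countable (R\<inverse> `` Y)" if "countable Y" for Y
  proof -
    have "R\<inverse> `` Y = (\<Union>y\<in>Y. {x. (x, y) \<in> R})" by blast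
    with assms that show ?thesis by simp
  qed
  then have "countable ((R\<inverse>)\<^sup>* `` {y})" by (intro countable_rtrancl) auto
  then show ?thesis by (simp add: rtrancl_converse Image_def)
qed

lemma tau_lt_omega1_eq_acc_tau_descent:
  fixes \<F> :: "'g::{group_add, countable} set set"
  assumes F: "left_invariant_family \<F>" "lower_family \<F>"
  shows "tau_lt_omega1 \<F> = Wellfounded.acc (tau_descent \<F>)"
proof (intro equalityI subsetI)
  fix A assume A: "A \<in> Wellfounded.acc (tau_descent \<F>)"
  define S where "S = {B. (B, A) \<in> (tau_descent \<F>)\<^sup>*}"
  have "S \<subseteq> Wellfounded.acc (tau_descent \<F>)" using acc_downwards[OF A] by (auto simp: S_def)
  then have "wf (Restr (tau_descent \<F>) S)"
    by (intro wf_subset[OF wf_Restr_acc]) auto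
  moreover have "countable (Restr (tau_descent \<F>) S)"
    unfolding S_def
    by (intro countable_Int2 countable_SIGMA countable_descendants
        countable_tau_descent_predecessors)
  ultimately have "countable_rank (Restr (tau_descent \<F>) S)"
    by (rule countable_rank_if_countable)
  then obtain r :: "nat rel" where "Well_order r" "S \<subseteq> tau_ord r \<F>"
    by (rule countable_rank_subset_tau_ord[OF F, rotated])
      (auto simp: S_def intro: converse_rtrancl_into_rtrancl)
  then show "A \<in> tau_lt_omega1 \<F>" by (auto simp: tau_lt_omega1_def S_def)
qed (use tau_ord_subset_acc_tau_descent[OF _ F] in \<open>auto simp: tau_lt_omega1_def\<close>)

section \<open>Borel families\<close>

lemma char_fam_eq_vimage: "char_fam \<F> = Collect -` \<F>"
  unfolding char_fam_def by (auto simp: image_iff intro!: bexI[of _ "Collect _"])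

lemma char_fam_acc: "char_fam (Wellfounded.acc R) = Wellfounded.acc (inv_image R Collect)"
proof -
  have "surj (Collect :: ('a \<Rightarrow> bool) \<Rightarrow> 'a set)" by (metis Collect_mem_eq surjI)
  then show ?thesis by (simp add: char_fam_eq_vimage acc_inv_image_surj)
qed

lemma borel_vimage_continuous:
  assumes "continuous_on UNIV f" "S \<in> sets borel"
  shows "f -` S \<in> sets borel"
  using measurable_sets[OF borel_measurable_continuous_onI assms(2)] assms(1) by simp

lemma borel_family_UN:
  assumes "countable I" "\<And>i. i \<in> I \<Longrightarrow> borel_family (\<F> i)"
  shows "borel_family (\<Union>i\<in>I. \<F> i)"
  using assms
  by (auto simp: borel_family_def char_fam_eq_vimage vimage_UN intro: sets.countable_UN')

lemma continuous_meet_translates: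
  fixes x y :: "'g::group_add"
  shows "continuous_on UNIV (\<lambda>a g. g \<in> meet_translates x y (Collect a))"
proof -
  have translate: "g \<in> (+) x ` B \<longleftrightarrow> - x + g \<in> B" for x g :: 'g and B
    by (force simp: image_iff add.assoc[symmetric] intro: bexI[of _ "- x + g"])
  have "(\<lambda>a g. g \<in> meet_translates x y (Collect a)) = (\<lambda>a g. min (a (- x + g)) (a (- y + g)))"
    by (auto simp: fun_eq_iff min_def meet_translates_def translate)
  then show ?thesis
    by (simp only:) (intro continuous_on_coordinatewise_then_product continuous_on_min
        continuous_on_coordinate)
qed

lemma borel_vimage_meet_translates:
  fixes x y :: "'g::group_add"
  assumes "borel_family \<F>"
  shows "{a. meet_translates x y (Collect a) \<in> \<F>} \<in> sets borel"
proof -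
  have "(\<lambda>a g. g \<in> meet_translates x y (Collect a)) -` char_fam \<F> \<in> sets borel"
    using assms unfolding borel_family_def
    by (intro borel_vimage_continuous continuous_meet_translates)
  then show ?thesis by (simp add: char_fam_eq_vimage vimage_def)
qed

lemma borel_family_tau_op:
  fixes \<F> :: "'g::{group_add, countable} set set"
  assumes "borel_family \<F>"
  shows "borel_family (tau_op \<F>)"
proof -
  have "char_fam (tau_op \<F>) =
      (\<Inter>(x, y) \<in> {(x, y). x \<noteq> y}. {a. meet_translates x y (Collect a) \<in> \<F>})"
    by (auto simp: char_fam_eq_vimage tau_op_def meet_translates_def)
  also have "\<dots> \<in> sets borel"
    using borel_vimage_meet_translates[OF assms] by (intro sets.countable_INT'') auto
  finally show ?thesis by (simp add: borel_family_def)
qed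

lemma borel_family_tau_ord:
  fixes \<F> :: "'g::{group_add, countable} set set"
  assumes "Well_order r" "borel_family \<F>"
  shows "borel_family (tau_ord r \<F>)"
  by (rule tau_ord_induct[where P = borel_family, OF assms])
    (simp add: borel_family_tau_op borel_family_UN)

lemma closed_graph_meet_translates:
  fixes x y :: "'g::{group_add, countable}"
  shows "closed {(b, a). Collect b = meet_translates x y (Collect a)}"
proof -
  have "{(b, a). Collect b = meet_translates x y (Collect a)} =
      {p. fst p = (\<lambda>g. g \<in> meet_translates x y (Collect (snd p)))}"
    by (auto simp: set_eq_iff fun_eq_iff)
  also have "closed \<dots>"
    by (intro closed_Collect_eq continuous_on_fst continuous_on_id
        continuous_on_compose2[OF continuous_meet_translates continuous_on_snd]) auto
  finally show ?thesis .
qed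

lemma borel_tau_descent:
  fixes \<F> :: "'g::{group_add, countable} set set"
  assumes "borel_family \<F>"
  shows "inv_image (tau_descent \<F>) Collect \<in> sets borel"
proof -
  let ?graph = "\<lambda>(x :: 'g) y. {(b, a). Collect b = meet_translates x y (Collect a)}"
  have tau_descent_eq: "inv_image (tau_descent \<F>) Collect =
      (\<Union>(x, y)\<in>{(x, y). x \<noteq> y}. ?graph x y) \<inter> fst -` (- char_fam \<F>)"
    by (auto simp: char_fam_eq_vimage tau_descent_def inv_image_def)
  have "(\<Union>(x, y)\<in>{(x, y). x \<noteq> y}. ?graph x y) \<in> sets borel"
    by (intro sets.countable_UN'' countableI_type)
      (auto intro: borel_closed closed_graph_meet_translates)
  moreover have "fst -` (- char_fam \<F>) \<in> sets borel"
    using assms unfolding borel_family_def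
    by (intro borel_vimage_continuous borel_comp continuous_on_fst[OF continuous_on_id])
  ultimately show ?thesis unfolding tau_descent_eq by (rule sets.Int)
qed

lemma baire_analytic_borel_rel:
  fixes R :: "('g::countable \<Rightarrow> bool) rel"
  assumes "R \<in> sets borel"
  shows "baire_analytic R"
  using baire_analytic_UNIV_square[OF baire_analytic_UNIV_discrete_fun] assms
  by (rule baire_analytic_borel)

lemma coanalytic_family_acc_tau_descent:
  fixes \<F> :: "'g::{group_add, countable} set set"
  assumes "borel_family \<F>"
  shows "coanalytic_family (Wellfounded.acc (tau_descent \<F>))"
  unfolding coanalytic_family_def char_fam_acc Compl_eq_Diff_UNIV[symmetric]
  by (intro analytic_set_if_baire_analytic baire_analytic_not_acc baire_analytic_borel_rel
      borel_tau_descent assms)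

lemma acc_tau_descent_subset_tau_ord_if_borel:
  fixes \<F> :: "'g::{group_add, countable} set set"
  assumes F: "borel_family \<F>" "left_invariant_family \<F>" "lower_family \<F>"
    and borel: "borel_family (Wellfounded.acc (tau_descent \<F>))"
  obtains r :: "nat rel" where "Well_order r" "Wellfounded.acc (tau_descent \<F>) \<subseteq> tau_ord r \<F>"
proof -
  let ?acc = "Wellfounded.acc (tau_descent \<F>)"
  define R where "R = inv_image (Restr (tau_descent \<F>) ?acc) Collect"
  have "wf R" unfolding R_def by (intro wf_inv_image wf_Restr_acc)
  have R_eq: "R = inv_image (tau_descent \<F>) Collect \<inter> snd -` char_fam ?acc"
    by (auto simp: R_def char_fam_eq_vimage inv_image_def dest: acc_downward)
  have "snd -` char_fam ?acc \<in> sets borel"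
    using borel unfolding borel_family_def
    by (intro borel_vimage_continuous continuous_on_snd[OF continuous_on_id])
  with borel_tau_descent[OF F(1)] have "R \<in> sets borel" unfolding R_eq by (rule sets.Int)
  then have "countable_rank R" by (intro kunen_martin \<open>wf R\<close> baire_analytic_borel_rel)
  then have "countable_rank (inv_image R (\<lambda>A g. g \<in> A))" by (rule countable_rank_inv_image)
  moreover have "inv_image R (\<lambda>A g. g \<in> A) = Restr (tau_descent \<F>) ?acc"
    by (auto simp: R_def inv_image_def)
  ultimately have "countable_rank (Restr (tau_descent \<F>) ?acc)" by simp
  then show thesis using countable_rank_subset_tau_ord[OF F(2,3)] acc_downward that by metis
qed

theorem theorem7p1:
  fixes \<F> :: "'g::{group_add, countable} set set"
  assumes "borel_family \<F>"
    and "left_invariant_family \<F>"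
    and "lower_family \<F>"
  shows "(\<forall>r::nat rel. Well_order r \<longrightarrow> borel_family (tau_ord r \<F>))
     \<and> tau_star \<F> = tau_lt_omega1 \<F>
     \<and> coanalytic_family (tau_star \<F>)
     \<and> ((\<forall>r::nat rel. Well_order r \<longrightarrow> tau_star \<F> \<noteq> tau_ord r \<F>)
          \<longrightarrow> \<not> borel_family (tau_star \<F>))"
proof (intro conjI allI impI notI)
  note star = tau_star_eq_acc_tau_descent[OF assms(2,3)]
  show "borel_family (tau_ord r \<F>)" if "Well_order r" for r :: "nat rel"
    using that assms(1) by (rule borel_family_tau_ord)
  show "tau_star \<F> = tau_lt_omega1 \<F>"
    unfolding star tau_lt_omega1_eq_acc_tau_descent[OF assms(2,3)] ..
  show "coanalytic_family (tau_star \<F>)"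
    unfolding star using assms(1) by (rule coanalytic_family_acc_tau_descent)
  assume not_tau_ord: "\<forall>r::nat rel. Well_order r \<longrightarrow> tau_star \<F> \<noteq> tau_ord r \<F>"
    and "borel_family (tau_star \<F>)"
  then obtain r :: "nat rel" where "Well_order r" "tau_star \<F> \<subseteq> tau_ord r \<F>"
    unfolding star using acc_tau_descent_subset_tau_ord_if_borel[OF assms] by blast
  moreover have "tau_ord r \<F> \<subseteq> tau_star \<F>"
    unfolding star using \<open>Well_order r\<close> assms(2,3) by (rule tau_ord_subset_acc_tau_descent)
  ultimately show False using not_tau_ord by blast
qed

end
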